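(* Let $X$ and $Y$ be real Banach spaces such that $\mathcal{K}(X,Y^* )$ is an $M$-ideal of infinite codimension in $\mathcal{L}(X,Y^* )$. Then no compact operator is a weak$^*$-norm PC in $S_{\mathcal{L}(X,Y^* )}$.
   Context: $S_Z$ denotes the unit sphere of a Banach space $Z$. $\mathcal{L}(X,Y^* )$ and $\mathcal{K}(X,Y^* )$ are the spaces of bounded, respectively compact, linear operators from $X$ to $Y^*$ with the operator norm. $\mathcal{L}(X,Y^* )$ is identified isometrically with the dual of the projective tensor product $X\hat{\otimes}_\pi Y$ via $T(x\otimes y)=(Tx)(y)$, and its weak$^*$-topology is always the one coming from this predual. A point $z_0^*\in S_{Z^*}$ is a weak$^*$-norm PC (point of continuity) in $S_{Z^*}$ if the identity map $(S_{Z^*},\text{weak}^* )\to(S_{Z^*},\|\cdot\|)$ is continuous at $z_0^*$. A closed subspace $J$ of a Banach space $Z$ is an $M$-ideal if there is a linear projection $P:Z^*\to Z^*$ with $\ker P=J^\perp$ and $\|z^*\|=\|P(z^* )\|+\|z^*-P(z^* )\|$ for all $z^*\in Z^*$. *)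

theory Defs
  imports "HOL-Analysis.Analysis"
begin

definition compact_operators :: "('a::real_normed_vector \<Rightarrow>\<^sub>L 'b::real_normed_vector) set" where
  "compact_operators = {T. compact (closure (blinfun_apply T ` cball 0 1))}"

text \<open>The quotient of the ambient space by \<open>J\<close> is finite-dimensional iff finitely many
  cosets span it, that is, iff \<open>J\<close> together with some finite set spans the whole space.\<close>

definition infinite_codimension :: "'a::real_vector set \<Rightarrow> bool" where
  "infinite_codimension J \<longleftrightarrow> \<not> (\<exists>B. finite B \<and> span (J \<union> B) = UNIV)"

definition annihilator :: "'a::real_normed_vector set \<Rightarrow> ('a \<Rightarrow>\<^sub>L real) set" where
  "annihilator J = {f. \<forall>z\<in>J. blinfun_apply f z = 0}"

definition M_ideal :: "'a::real_normed_vector set \<Rightarrow> bool" where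
  "M_ideal J \<longleftrightarrow> subspace J \<and> closed J \<and>
     (\<exists>P :: ('a \<Rightarrow>\<^sub>L real) \<Rightarrow> ('a \<Rightarrow>\<^sub>L real).
        linear P \<and> P \<circ> P = P \<and> {f. P f = 0} = annihilator J \<and>
        (\<forall>f. norm f = norm (P f) + norm (f - P f)))"

text \<open>An element of the algebraic tensor product is represented by a list of pairs, the list
  \<open>[(x\<^sub>1, y\<^sub>1), \<dots>, (x\<^sub>n, y\<^sub>n)]\<close> standing for the sum of the \<open>x\<^sub>i \<otimes> y\<^sub>i\<close>. Scalars are
  absorbed by the vectors. By the universal property, a bilinear form extends linearly to
  the tensor product, and two lists denote the same tensor iff all bilinear forms (bounded or
  not) agree on them.\<close>

definition tensor_apply :: "('a \<Rightarrow> 'b \<Rightarrow> real) \<Rightarrow> ('a \<times> 'b) list \<Rightarrow> real" where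
  "tensor_apply B us = (\<Sum>(x, y)\<leftarrow>us. B x y)"

definition tensor_eq :: "('a::real_vector \<times> 'b::real_vector) list \<Rightarrow> ('a \<times> 'b) list \<Rightarrow> bool" where
  "tensor_eq us vs \<longleftrightarrow>
     (\<forall>B :: 'a \<Rightarrow> 'b \<Rightarrow> real. bilinear B \<longrightarrow> tensor_apply B us = tensor_apply B vs)"

definition tensor_diff ::
  "('a::real_vector \<times> 'b::real_vector) list \<Rightarrow> ('a \<times> 'b) list \<Rightarrow> ('a \<times> 'b) list" where
  "tensor_diff us vs = us @ map (\<lambda>(x, y). (- x, y)) vs"

definition projective_norm ::
  "('a::real_normed_vector \<times> 'b::real_normed_vector) list \<Rightarrow> real" where
  "projective_norm us = Inf {(\<Sum>(x, y)\<leftarrow>vs. norm x * norm y) | vs. tensor_eq vs us}"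

text \<open>The completed projective tensor product consists of the Cauchy sequences for the
  projective norm. Sequences at distance zero from each other are not identified, since
  operators take the same value on them (\<open>projective_pairing_cong\<close>).\<close>

definition projective_tensors ::
  "(nat \<Rightarrow> ('a::real_normed_vector \<times> 'b::real_normed_vector) list) set" where
  "projective_tensors =
     {u. \<forall>e>0. \<exists>N. \<forall>m\<ge>N. \<forall>n\<ge>N. projective_norm (tensor_diff (u m) (u n)) < e}"

text \<open>The duality \<open>T (x \<otimes> y) = (T x) y\<close>, extended by linearity and continuity.\<close>

definition projective_pairing ::
  "('a::real_normed_vector \<Rightarrow>\<^sub>L ('b::real_normed_vector \<Rightarrow>\<^sub>L real)) \<Rightarrow>
     (nat \<Rightarrow> ('a \<times> 'b) list) \<Rightarrow> real" where
  "projective_pairing T u = lim (\<lambda>n. tensor_apply (\<lambda>x y. T x y) (u n))"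

definition weak_star ::
  "('a::real_normed_vector \<Rightarrow>\<^sub>L ('b::real_normed_vector \<Rightarrow>\<^sub>L real)) topology" where
  "weak_star = topology_generated_by
     {{T. projective_pairing T u \<in> U} | u U. u \<in> projective_tensors \<and> open U}"

text \<open>\<open>topcontinuous_at\<close> includes membership of \<open>T\<close> in the unit sphere.\<close>

definition weak_star_norm_PC ::
  "('a::real_normed_vector \<Rightarrow>\<^sub>L ('b::real_normed_vector \<Rightarrow>\<^sub>L real)) \<Rightarrow> bool" where
  "weak_star_norm_PC T \<longleftrightarrow>
     topcontinuous_at (subtopology weak_star (sphere 0 1)) (top_of_set (sphere 0 1)) id T"

lemma tensor_apply_diff:
  assumes "bilinear B"
  shows "tensor_apply B (tensor_diff us vs) = tensor_apply B us - tensor_apply B vs"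
proof -
  have "tensor_apply B (map (\<lambda>(x, y). (- x, y)) vs) = - tensor_apply B vs"
    by (induction vs) (auto simp: tensor_apply_def bilinear_lneg[OF assms])
  then show ?thesis
    by (simp add: tensor_diff_def tensor_apply_def)
qed

lemma bilinear_blinfun2:
  "bilinear (\<lambda>x y. blinfun_apply (blinfun_apply T x) y)"
  unfolding bilinear_def
  by (auto intro!: linearI simp: blinfun.add_right blinfun.scaleR_right
      blinfun.add_left blinfun.scaleR_left)

lemma abs_tensor_apply_le:
  "\<bar>tensor_apply (\<lambda>x y. blinfun_apply (blinfun_apply T x) y) us\<bar> \<le> norm T * projective_norm us"
proof -
  have le: "\<bar>tensor_apply (\<lambda>x y. T x y) vs\<bar> \<le> norm T * (\<Sum>(x, y)\<leftarrow>vs. norm x * norm y)" for vs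
  proof (induction vs)
    case (Cons p vs)
    obtain x y where p: "p = (x, y)" by force
    have "\<bar>T x y\<bar> \<le> norm T * (norm x * norm y)"
      using norm_blinfun[of "T x" y] mult_right_mono[OF norm_blinfun[of T x], of "norm y"]
      by (simp add: mult.assoc)
    then show ?case
      using Cons by (simp add: p tensor_apply_def distrib_left)
  qed (simp add: tensor_apply_def)
  show ?thesis
  proof (cases "norm T = 0")
    case True
    then show ?thesis using le[of us] by simp
  next
    case False
    have "\<bar>tensor_apply (\<lambda>x y. T x y) us\<bar> / norm T \<le> projective_norm us"
      unfolding projective_norm_def
    proof (rule cInf_greatest)
      show "{(\<Sum>(x, y)\<leftarrow>vs. norm x * norm y) | vs. tensor_eq vs us} \<noteq> {}"
        by (auto simp: tensor_eq_def)
    next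
      fix r assume "r \<in> {(\<Sum>(x, y)\<leftarrow>vs. norm x * norm y) | vs. tensor_eq vs us}"
      then obtain vs where r: "r = (\<Sum>(x, y)\<leftarrow>vs. norm x * norm y)" and "tensor_eq vs us"
        by auto
      then have "tensor_apply (\<lambda>x y. T x y) us = tensor_apply (\<lambda>x y. T x y) vs"
        using bilinear_blinfun2[of T] by (auto simp: tensor_eq_def)
      then show "\<bar>tensor_apply (\<lambda>x y. T x y) us\<bar> / norm T \<le> r"
        using le[of vs] False by (simp add: r divide_le_eq mult.commute)
    qed
    then show ?thesis using False by (simp add: divide_le_eq mult.commute)
  qed
qed

lemma projective_pairing_LIMSEQ:
  assumes "u \<in> projective_tensors"
  shows "(\<lambda>n. tensor_apply (\<lambda>x y. blinfun_apply (blinfun_apply T x) y) (u n))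
           \<longlonglongrightarrow> projective_pairing T u"
proof -
  have "Cauchy (\<lambda>n. tensor_apply (\<lambda>x y. T x y) (u n))"
  proof (rule metric_CauchyI)
    fix e :: real assume e: "e > 0"
    have pos: "0 < norm T + 1" by (simp add: add_nonneg_pos)
    obtain N where N: "projective_norm (tensor_diff (u m) (u n)) < e / (norm T + 1)"
      if "m \<ge> N" "n \<ge> N" for m n
      using assms e pos unfolding projective_tensors_def
      by simp (metis divide_pos_pos)
    have "dist (tensor_apply (\<lambda>x y. T x y) (u m)) (tensor_apply (\<lambda>x y. T x y) (u n)) < e"
      if mn: "m \<ge> N" "n \<ge> N" for m n
    proof -
      let ?d = "tensor_diff (u m) (u n)"
      have "dist (tensor_apply (\<lambda>x y. T x y) (u m)) (tensor_apply (\<lambda>x y. T x y) (u n))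
              \<le> norm T * projective_norm ?d"
        using abs_tensor_apply_le[of T ?d] tensor_apply_diff[OF bilinear_blinfun2, of T "u m" "u n"]
        by (simp add: dist_real_def)
      also have "\<dots> \<le> norm T * (e / (norm T + 1))"
        using N[OF mn] by (intro mult_left_mono) auto
      also have "\<dots> < e" using e pos by (simp add: field_simps)
      finally show ?thesis .
    qed
    then show "\<exists>M. \<forall>m\<ge>M. \<forall>n\<ge>M.
        dist (tensor_apply (\<lambda>x y. T x y) (u m)) (tensor_apply (\<lambda>x y. T x y) (u n)) < e"
      by blast
  qed
  then show ?thesis
    by (simp add: projective_pairing_def Cauchy_convergent_iff convergent_LIMSEQ_iff)
qed

lemma projective_pairing_cong:
  assumes u: "u \<in> projective_tensors" and v: "v \<in> projective_tensors"
    and uv: "(\<lambda>n. projective_norm (tensor_diff (u n) (v n))) \<longlonglongrightarrow> 0"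
  shows "projective_pairing T u = projective_pairing T v"
proof -
  have "(\<lambda>n. tensor_apply (\<lambda>x y. T x y) (u n) - tensor_apply (\<lambda>x y. T x y) (v n)) \<longlonglongrightarrow> 0"
  proof (rule Lim_null_comparison[OF always_eventually])
    show "\<forall>n. norm (tensor_apply (\<lambda>x y. T x y) (u n) - tensor_apply (\<lambda>x y. T x y) (v n))
            \<le> norm T * projective_norm (tensor_diff (u n) (v n))"
      using abs_tensor_apply_le[of T] by (simp flip: tensor_apply_diff[OF bilinear_blinfun2])
    show "(\<lambda>n. norm T * projective_norm (tensor_diff (u n) (v n))) \<longlonglongrightarrow> 0"
      using tendsto_mult_left[OF uv, of "norm T"] by simp
  qed
  moreover have "(\<lambda>n. tensor_apply (\<lambda>x y. T x y) (u n) - tensor_apply (\<lambda>x y. T x y) (v n))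
      \<longlonglongrightarrow> projective_pairing T u - projective_pairing T v"
    by (intro tendsto_diff projective_pairing_LIMSEQ u v)
  ultimately show ?thesis
    using LIMSEQ_unique by fastforce
qed

end

theory Submission
  imports Defs
begin

text \<open>This is a fact about M-ideals: if \<open>J\<close> is an M-ideal of infinite codimension in a normed space
  \<open>Z\<close>, then no point of \<open>J\<close> is a weak-norm point of continuity of the unit sphere of \<open>Z\<close>
  (\<open>M_ideal_weak_neighbourhood_large\<close>). Each element of the projective tensor product acts on
  \<open>Z = L(X, Y*)\<close> as a bounded linear functional, so the weak-star topology is coarser than the
  weak one and the conclusion passes to it.

  The M-projection \<open>P\<close> splits \<open>Z*\<close> as an \<open>l1\<close>-sum of the annihilator of \<open>J\<close> and the range
  of \<open>P\<close>, so \<open>Z**\<close> is an \<open>l\<infinity>\<close>-sum. Let \<open>t \<in> J\<close> and \<open>z \<in> Z\<close> be of norm one. In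
  \<open>Z**\<close> the vector \<open>z - P* z\<close> lies in the summand complementary to the one containing \<open>t\<close>, hence
  \<open>t + (z - P* z)\<close> has norm at most one, and \<open>z - P* z\<close> takes the value \<open>(u - P u)(z)\<close> at
  \<open>u \<in> Z*\<close>. Given finitely many functionals \<open>u\<close>, the functionals \<open>u - P u\<close> live on the
  infinite-dimensional space \<open>Z/J\<close>, so some \<open>z\<close> away from \<open>J\<close> is killed by all of them
  (\<open>exists_unit_vector_far_from_subspace\<close>). Approximating \<open>z - P* z\<close> by elements \<open>w\<close> of the
  coset \<open>z + J\<close> (\<open>M_ideal_coset_approximation\<close>) yields a vector \<open>t + w\<close> of norm almost one on
  which the given functionals take almost the same values as on \<open>t\<close>, whereas \<open>w\<close> stays away from
  zero because its coset does.

  The approximation step is proved without the bidual, by convex duality: if no \<open>w\<close> in the coset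
  were good enough, the Mazur-Orlicz form of the Hahn-Banach theorem (\<open>mazur_orlicz\<close>) would give a
  functional that contradicts the norm identity for \<open>P\<close>.\<close>

section \<open>The Hahn-Banach theorem in the form of Mazur and Orlicz\<close>

definition sublinear :: "('a::real_vector \<Rightarrow> real) \<Rightarrow> bool" where
  "sublinear p \<longleftrightarrow> (\<forall>x y. p (x + y) \<le> p x + p y) \<and> (\<forall>t x. 0 \<le> t \<longrightarrow> p (t *\<^sub>R x) \<le> t * p x)"

lemma sublinearI:
  assumes "\<And>x y. p (x + y) \<le> p x + p y" "\<And>t x. 0 \<le> t \<Longrightarrow> p (t *\<^sub>R x) \<le> t * p x"
  shows "sublinear p"
  using assms by (simp add: sublinear_def)

lemma sublinear_add: "sublinear p \<Longrightarrow> p (x + y) \<le> p x + p y"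
  and sublinear_scaleR_le: "sublinear p \<Longrightarrow> 0 \<le> t \<Longrightarrow> p (t *\<^sub>R x) \<le> t * p x"
  by (auto simp: sublinear_def)

lemma sublinear_zero:
  assumes "sublinear p"
  shows "p 0 = 0"
  using sublinear_add[OF assms, of 0 0] sublinear_scaleR_le[OF assms, of 0 0] by simp

lemma sublinear_scaleR:
  assumes "sublinear p" "0 \<le> t"
  shows "p (t *\<^sub>R x) = t * p x"
proof (cases "t = 0")
  case True
  then show ?thesis using sublinear_zero[OF assms(1)] by simp
next
  case False
  then have "p x \<le> inverse t * p (t *\<^sub>R x)"
    using sublinear_scaleR_le[OF assms(1), of "inverse t" "t *\<^sub>R x"] assms(2) by simp
  then have "t * p x \<le> p (t *\<^sub>R x)"
    using False assms(2) by (simp add: field_simps)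
  then show ?thesis
    using sublinear_scaleR_le[OF assms] by (intro antisym) auto
qed

lemma sublinear_minus_le:
  assumes "sublinear p"
  shows "- p (- x) \<le> p x"
  using sublinear_add[OF assms, of x "- x"] sublinear_zero[OF assms] by simp

text \<open>The new functional is \<open>x \<mapsto> inf {p (x + t c) - t m | t \<ge> 0, c \<in> C}\<close>. It is the largest
  sublinear functional below \<open>p\<close> with the stated property; convexity of \<open>C\<close> makes it subadditive.
  Every linear functional below it is at least \<open>m\<close> on \<open>C\<close>, which is how a lower bound for \<open>p\<close>
  is passed on to linear functionals.\<close>

lemma sublinear_reduction:
  fixes p :: "'a::real_vector \<Rightarrow> real"
  assumes p: "sublinear p" and C: "convex C" "C \<noteq> {}" and m: "\<And>c. c \<in> C \<Longrightarrow> m \<le> p c"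
  obtains q where "sublinear q" "\<And>x. q x \<le> p x" "\<And>c. c \<in> C \<Longrightarrow> q (- c) \<le> - m"
proof -
  define V where "V x = {p (x + t *\<^sub>R c) - t * m | t c. 0 \<le> t \<and> c \<in> C}" for x
  define q where "q x = Inf (V x)" for x
  have V_I: "p (x + t *\<^sub>R c) - t * m \<in> V x" if "0 \<le> t" "c \<in> C" for x t c
    using that by (auto simp: V_def)
  have lower: "- p (- x) \<le> v" if v: "v \<in> V x" for x v
  proof -
    obtain t c where tc: "0 \<le> t" "c \<in> C" "v = p (x + t *\<^sub>R c) - t * m"
      using v by (auto simp: V_def)
    have "t * m \<le> p (t *\<^sub>R c)"
      using m[OF tc(2)] tc(1) sublinear_scaleR[OF p tc(1)] by (simp add: mult_left_mono)
    then show ?thesis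
      using sublinear_add[OF p, of "x + t *\<^sub>R c" "- x"] tc(3) by simp
  qed
  have bdd: "bdd_below (V x)" for x
    using lower by (auto intro!: bdd_belowI)
  have nonempty: "V x \<noteq> {}" for x
    using V_I[of 0] C(2) by blast
  have q_le: "q x \<le> v" if "v \<in> V x" for x v
    unfolding q_def using that bdd by (intro cInf_lower)
  have q_ge: "b \<le> q x" if "\<And>v. v \<in> V x \<Longrightarrow> b \<le> v" for b x
    unfolding q_def using that nonempty by (intro cInf_greatest)
  have "q (x + y) \<le> q x + q y" for x y
  proof -
    have sum: "q (x + y) \<le> v + w" if vw: "v \<in> V x" "w \<in> V y" for v w
    proof -
      obtain s c where sc: "0 \<le> s" "c \<in> C" "v = p (x + s *\<^sub>R c) - s * m"
        using vw(1) by (auto simp: V_def)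
      obtain t d where td: "0 \<le> t" "d \<in> C" "w = p (y + t *\<^sub>R d) - t * m"
        using vw(2) by (auto simp: V_def)
      obtain e where e: "e \<in> C" "s *\<^sub>R c + t *\<^sub>R d = (s + t) *\<^sub>R e"
      proof (cases "s + t = 0")
        case True
        then have "s = 0" "t = 0" using sc td by auto
        then show ?thesis using that[OF sc(2)] by simp
      next
        case False
        have "(s / (s + t)) *\<^sub>R c + (t / (s + t)) *\<^sub>R d \<in> C"
          using C(1) sc td False by (intro convexD) (auto simp flip: add_divide_distrib)
        then show ?thesis
          using False by (intro that) (auto simp: scaleR_add_right)
      qed
      have "p (x + y + (s + t) *\<^sub>R e) \<le> p (x + s *\<^sub>R c) + p (y + t *\<^sub>R d)"
        using sublinear_add[OF p, of "x + s *\<^sub>R c" "y + t *\<^sub>R d"]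
        unfolding e(2)[symmetric] by (simp only: add_ac)
      then show ?thesis
        using q_le[OF V_I[of "s + t" e "x + y"]] sc td e(1) by (simp add: algebra_simps)
    qed
    have "q (x + y) - w \<le> q x" if "w \<in> V y" for w
      using sum[OF _ that] by (intro q_ge) (simp add: algebra_simps)
    then have "q (x + y) - q x \<le> q y"
      by (intro q_ge) (simp add: algebra_simps)
    then show ?thesis by simp
  qed
  moreover have "q (t *\<^sub>R x) \<le> t * q x" if t: "0 \<le> t" for t x
  proof (cases "t = 0")
    case True
    obtain c where "c \<in> C" using C(2) by auto
    from q_le[OF V_I[OF order.refl this, of 0]] show ?thesis
      using True sublinear_zero[OF p] by simp
  next
    case False
    have "q (t *\<^sub>R x) / t \<le> v" if v: "v \<in> V x" for v
    proof -
      obtain s c where sc: "0 \<le> s" "c \<in> C" "v = p (x + s *\<^sub>R c) - s * m"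
        using v by (auto simp: V_def)
      have "q (t *\<^sub>R x) \<le> p (t *\<^sub>R (x + s *\<^sub>R c)) - t * s * m"
        using q_le[OF V_I[of "t * s" c "t *\<^sub>R x"]] sc t by (simp add: scaleR_add_right)
      also have "\<dots> = t * v"
        unfolding sublinear_scaleR[OF p t] sc(3) by (simp add: algebra_simps)
      finally show ?thesis using t False by (simp add: divide_le_eq mult.commute)
    qed
    then have "q (t *\<^sub>R x) / t \<le> q x" by (intro q_ge)
    then show ?thesis using t False by (simp add: divide_le_eq mult.commute)
  qed
  ultimately have "sublinear q" by (rule sublinearI)
  moreover have "q x \<le> p x" for x
  proof -
    obtain c where "c \<in> C" using C(2) by auto
    from q_le[OF V_I[OF order.refl this, of x]] show ?thesis by simp
  qed
  moreover have "q (- c) \<le> - m" if "c \<in> C" for c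
    using q_le[OF V_I[of 1 c "- c"]] that sublinear_zero[OF p] by simp
  ultimately show ?thesis by (rule that)
qed

text \<open>A minimal sublinear functional is linear: reducing a minimal \<open>q\<close> at a single point \<open>y\<close> with \<open>m = q y\<close> does not change it, which forces
  \<open>q (- y) = - q y\<close>. Minimal ones exist by Zorn's lemma, as the pointwise infimum of a chain is
  sublinear again.\<close>

lemma exists_linear_below_sublinear:
  fixes p :: "'a::real_vector \<Rightarrow> real"
  assumes p: "sublinear p"
  obtains F where "linear F" "\<And>x. F x \<le> p x"
proof -
  define A where "A = {q. sublinear q \<and> q \<le> p}"
  define R where "R = relation_of (\<lambda>q r. r \<le> q) A"
  have "partial_order_on A R"
    unfolding R_def by (rule partial_order_on_relation_ofI) auto
  moreover have "\<exists>r\<in>A. \<forall>q\<in>\<C>. r \<le> q" if \<C>: "\<C> \<in> Chains R" for \<C>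
  proof (cases "\<C> = {}")
    case True
    then show ?thesis using p by (auto simp: A_def)
  next
    case False
    have in_A: "sublinear q" "q \<le> p" if "q \<in> \<C>" for q
      using \<C> that by (auto simp: Chains_def R_def relation_of_def A_def)
    have chain: "q \<le> r \<or> r \<le> q" if "q \<in> \<C>" "r \<in> \<C>" for q r
      using \<C> that by (auto simp: Chains_def R_def relation_of_def)
    define i where "i x = (INF q\<in>\<C>. q x)" for x
    have "- p (- x) \<le> q x" if "q \<in> \<C>" for q x
      using sublinear_minus_le[OF in_A(1)[OF that], of x] le_funD[OF in_A(2)[OF that], of "- x"]
      by simp
    then have i_le: "i x \<le> q x" if "q \<in> \<C>" for q x
      unfolding i_def using that by (auto intro!: cINF_lower bdd_belowI2)
    have i_ge: "b \<le> i x" if "\<And>q. q \<in> \<C> \<Longrightarrow> b \<le> q x" for b x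
      unfolding i_def using that False by (intro cINF_greatest)
    have "i (x + y) \<le> i x + i y" for x y
    proof -
      have sum: "i (x + y) \<le> q x + r y" if qr: "q \<in> \<C>" "r \<in> \<C>" for q r
        using chain[OF qr]
      proof
        assume "q \<le> r"
        then show ?thesis
          using i_le[OF qr(1), of "x + y"] sublinear_add[OF in_A(1)[OF qr(1)], of x y]
            le_funD[of q r y] by simp
      next
        assume "r \<le> q"
        then show ?thesis
          using i_le[OF qr(2), of "x + y"] sublinear_add[OF in_A(1)[OF qr(2)], of x y]
            le_funD[of r q x] by simp
      qed
      have "i (x + y) - r y \<le> i x" if "r \<in> \<C>" for r
        using sum[OF _ that] by (intro i_ge) (simp add: algebra_simps)
      then have "i (x + y) - i x \<le> i y"
        by (intro i_ge) (simp add: algebra_simps)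
      then show ?thesis by simp
    qed
    moreover have "i (t *\<^sub>R x) \<le> t * i x" if t: "0 \<le> t" for t x
    proof (cases "t = 0")
      case True
      obtain q where "q \<in> \<C>" using False by auto
      then show ?thesis
        using i_le[of q 0] sublinear_zero[OF in_A(1), of q] True by simp
    next
      case t0: False
      have "i (t *\<^sub>R x) / t \<le> q x" if "q \<in> \<C>" for q
        using i_le[OF that, of "t *\<^sub>R x"] sublinear_scaleR[OF in_A(1)[OF that] t] t t0
        by (simp add: divide_le_eq mult.commute)
      then have "i (t *\<^sub>R x) / t \<le> i x" by (intro i_ge)
      then show ?thesis using t t0 by (simp add: divide_le_eq mult.commute)
    qed
    ultimately have "sublinear i" by (rule sublinearI)
    moreover obtain q where "q \<in> \<C>" using False by auto
    ultimately have "i \<in> A"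
      using i_le in_A(2) by (fastforce simp: A_def le_fun_def intro: order.trans)
    then show ?thesis using i_le by (auto simp: le_fun_def)
  qed
  ultimately obtain q where q: "q \<in> A" and minimal: "\<And>r. r \<in> A \<Longrightarrow> r \<le> q \<Longrightarrow> r = q"
    using predicate_Zorn[of A "\<lambda>q r. r \<le> q"] unfolding R_def by blast
  have sub: "sublinear q" and le: "q x \<le> p x" for x
    using q by (auto simp: A_def le_fun_def)
  have odd: "q (- y) = - q y" for y
  proof -
    obtain r where r: "sublinear r" "\<And>x. r x \<le> q x" "\<And>c. c \<in> {y} \<Longrightarrow> r (- c) \<le> - q y"
      using sublinear_reduction[OF sub, of "{y}" "q y"] by auto
    have "r = q"
      using minimal[of r] r(1,2) le by (force simp: A_def le_fun_def intro: order.trans)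
    then show ?thesis
      using r(3)[of y] sublinear_minus_le[OF sub, of y] by simp
  qed
  have "linear q"
  proof (rule linearI)
    fix x y
    show "q (x + y) = q x + q y"
      using sublinear_add[OF sub, of x y] sublinear_add[OF sub, of "- x" "- y"]
        odd[of "x + y"] odd[of x] odd[of y] by simp
  next
    fix t :: real and x
    show "q (t *\<^sub>R x) = t *\<^sub>R q x"
    proof (cases "0 \<le> t")
      case True
      then show ?thesis using sublinear_scaleR[OF sub] by simp
    next
      case False
      then show ?thesis
        using sublinear_scaleR[OF sub, of "- t" x] odd[of "t *\<^sub>R x"] by simp
    qed
  qed
  then show ?thesis using le by (rule that)
qed

text \<open>For a point \<open>C = {x}\<close> this is the existence of a functional supporting \<open>p\<close> at \<open>x\<close>. For
  an affine subspace \<open>C\<close> it is duality for a convex minimisation problem: \<open>F\<close> is constant on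
  \<open>C\<close>, being bounded below there, and for \<open>m = inf p(C)\<close> its value is the infimum of \<open>p\<close> over \<open>C\<close>.\<close>

lemma mazur_orlicz:
  fixes p :: "'a::real_vector \<Rightarrow> real"
  assumes p: "sublinear p" and C: "convex C" "C \<noteq> {}" and m: "\<And>c. c \<in> C \<Longrightarrow> m \<le> p c"
  obtains F where "linear F" "\<And>x. F x \<le> p x" "\<And>c. c \<in> C \<Longrightarrow> m \<le> F c"
proof -
  obtain q where q: "sublinear q" "\<And>x. q x \<le> p x" "\<And>c. c \<in> C \<Longrightarrow> q (- c) \<le> - m"
    using sublinear_reduction[OF assms] by blast
  obtain F where F: "linear F" "\<And>x. F x \<le> q x"
    using exists_linear_below_sublinear[OF q(1)] by blast
  have "m \<le> F c" if "c \<in> C" for c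
    using order.trans[OF F(2) q(3)[OF that]] linear_neg[OF F(1)] by simp
  then show ?thesis
    using that[OF F(1)] order.trans[OF F(2) q(2)] by blast
qed

lemma sublinear_norm: "sublinear (norm :: 'a::real_normed_vector \<Rightarrow> real)"
  by (rule sublinearI) (auto intro: norm_triangle_ineq)

lemma blinfun_of_linear_le_norm:
  fixes F :: "'a::real_normed_vector \<Rightarrow> real"
  assumes F: "linear F" and le: "\<And>x. F x \<le> norm x"
  obtains f where "blinfun_apply f = F" "norm f \<le> 1"
proof -
  have abs: "\<bar>F x\<bar> \<le> norm x" for x
    using le[of x] le[of "- x"] linear_neg[OF F] by (simp add: abs_le_iff)
  have "bounded_linear F"
    using F abs by (intro bounded_linear_intro[where K = 1]) (auto simp: linear_add linear_cmul)
  then have F_eq: "blinfun_apply (Blinfun F) = F"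
    by (rule bounded_linear_Blinfun_apply)
  then show ?thesis
    using abs by (intro that norm_blinfun_bound) auto
qed

lemma exists_norming_functional:
  fixes x :: "'a::real_normed_vector"
  obtains f :: "'a \<Rightarrow>\<^sub>L real" where "norm f \<le> 1" "f x = norm x"
proof -
  obtain F where F: "linear F" "\<And>y. F y \<le> norm y" "\<And>y. y \<in> {x} \<Longrightarrow> norm x \<le> F y"
    using mazur_orlicz[OF sublinear_norm, of "{x}" "norm x"] by auto
  obtain f where f: "blinfun_apply f = F" "norm f \<le> 1"
    using blinfun_of_linear_le_norm[OF F(1,2)] by blast
  have "f x = norm x"
    using F(2)[of x] F(3)[of x] f(1) by simp
  with f(2) show ?thesis by (rule that)
qed

section \<open>Finitely many functionals\<close>

lemma blinfun_in_span_if_kernel: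
  fixes g :: "'a::real_normed_vector \<Rightarrow>\<^sub>L real"
  assumes "finite U" and "\<And>x. (\<forall>u\<in>U. blinfun_apply u x = 0) \<Longrightarrow> g x = 0"
  shows "g \<in> span U"
  using assms
proof (induction U arbitrary: g)
  case empty
  then have "g = 0" by (intro blinfun_eqI) simp
  then show ?case by simp
next
  case (insert u U)
  show ?case
  proof (cases "\<exists>w. (\<forall>v\<in>U. v w = 0) \<and> u w \<noteq> 0")
    case True
    then obtain w where w: "\<And>v. v \<in> U \<Longrightarrow> v w = 0" "u w \<noteq> 0" by blast
    define h where "h = g - (g w / u w) *\<^sub>R u"
    have "h x = 0" if x: "\<forall>v\<in>U. v x = 0" for x
    proof -
      have "g (x - (u x / u w) *\<^sub>R w) = 0"
        using x w by (intro insert.prems) (auto simp: blinfun.diff_right blinfun.scaleR_right)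
      then show ?thesis
        by (simp add: h_def blinfun.diff_right blinfun.scaleR_right blinfun.diff_left
            blinfun.scaleR_left)
    qed
    then have "h \<in> span U" by (rule insert.IH)
    then have "h \<in> span (insert u U)"
      using span_mono[OF subset_insertI, of U u] by (rule rev_subsetD)
    then have "h + (g w / u w) *\<^sub>R u \<in> span (insert u U)"
      by (rule span_add) (auto intro: span_scale span_base)
    then show ?thesis by (simp add: h_def)
  next
    case False
    then have "g \<in> span U" by (intro insert.IH insert.prems) auto
    then show ?thesis using span_mono[OF subset_insertI, of U u] by (rule rev_subsetD)
  qed
qed

lemma finite_codimension_common_kernel:
  fixes U :: "('a::real_normed_vector \<Rightarrow>\<^sub>L real) set"
  assumes "finite U"
  shows "\<exists>B. finite B \<and> span ({x. \<forall>u\<in>U. blinfun_apply u x = 0} \<union> B) = UNIV"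
  using assms
proof (induction U)
  case empty
  show ?case by (intro exI[of _ "{}"]) simp
next
  case (insert u U)
  let ?N = "{x. \<forall>v\<in>U. blinfun_apply v x = 0}"
  let ?N' = "{x. \<forall>v\<in>insert u U. blinfun_apply v x = 0}"
  obtain B where B: "finite B" "span (?N \<union> B) = UNIV"
    using insert.IH by auto
  show ?case
  proof (cases "\<exists>w\<in>?N. u w \<noteq> 0")
    case True
    then obtain w where w: "w \<in> ?N" "u w \<noteq> 0" by blast
    have "x \<in> span (?N' \<union> insert w B)" if x: "x \<in> ?N" for x
    proof -
      have "x - (u x / u w) *\<^sub>R w \<in> ?N'"
        using x w by (auto simp: blinfun.diff_right blinfun.scaleR_right)
      then have "(x - (u x / u w) *\<^sub>R w) + (u x / u w) *\<^sub>R w \<in> span (?N' \<union> insert w B)"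
        by (intro span_add span_scale span_base) auto
      then show ?thesis by simp
    qed
    then have "span (?N \<union> B) \<subseteq> span (?N' \<union> insert w B)"
      by (intro span_minimal subspace_span) (auto intro: span_base)
    then show ?thesis using B by (intro exI[of _ "insert w B"]) auto
  next
    case False
    then have "?N' = ?N" by auto
    then show ?thesis using B by auto
  qed
qed

text \<open>Riesz's lemma, carried out inside the common kernel of \<open>V\<close>. Having finite codimension, that
  kernel is not contained in \<open>J\<close>; and as \<open>V\<close> vanishes on \<open>J\<close>, correcting a vector of the
  kernel by an element of \<open>J\<close> does not leave the kernel.\<close>

lemma exists_unit_vector_far_from_subspace:
  fixes J :: "'a::real_normed_vector set"
  assumes J: "subspace J" "closed J" "infinite_codimension J"
    and V: "finite V" "V \<subseteq> annihilator J"
  obtains z where "norm z = 1" "\<And>v. v \<in> V \<Longrightarrow> blinfun_apply v z = 0"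
    "\<And>j. j \<in> J \<Longrightarrow> 1 / 2 \<le> norm (z - j)"
proof -
  obtain B where B: "finite B" "span ({x. \<forall>v\<in>V. blinfun_apply v x = 0} \<union> B) = UNIV"
    using finite_codimension_common_kernel[OF V(1)] by blast
  have "\<not> {x. \<forall>v\<in>V. blinfun_apply v x = 0} \<subseteq> J"
  proof
    assume "{x. \<forall>v\<in>V. blinfun_apply v x = 0} \<subseteq> J"
    then have "span (J \<union> B) = UNIV"
      using B(2) span_mono[of "{x. \<forall>v\<in>V. blinfun_apply v x = 0} \<union> B" "J \<union> B"] by blast
    with B(1) J(3) show False by (auto simp: infinite_codimension_def)
  qed
  then obtain y where y: "\<And>v. v \<in> V \<Longrightarrow> blinfun_apply v y = 0" "y \<notin> J" by blast
  have J_ne: "J \<noteq> {}" using subspace_0[OF J(1)] by auto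
  define d where "d = infdist y J"
  have d: "0 < d"
    using in_closed_iff_infdist_zero[OF J(2) J_ne, of y] y(2) infdist_nonneg[of y J]
    unfolding d_def by linarith
  have "infdist y J < 2 * d" using d by (simp add: d_def)
  then obtain i where i: "i \<in> J" "norm (y - i) < 2 * d"
    using infdist_notempty[OF J_ne, of y] cInf_lessD[of "dist y ` J" "2 * d"] J_ne
    by (auto simp: dist_norm)
  define r where "r = norm (y - i)"
  have r: "0 < r" using i(1) y(2) by (auto simp: r_def)
  define z where "z = (1 / r) *\<^sub>R (y - i)"
  show ?thesis
  proof (rule that)
    show "norm z = 1" using r by (simp add: z_def r_def)
    show "blinfun_apply v z = 0" if "v \<in> V" for v
      using that y(1) i(1) V(2)
      by (auto simp: z_def annihilator_def blinfun.scaleR_right blinfun.diff_right)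
    show "1 / 2 \<le> norm (z - j)" if j: "j \<in> J" for j
    proof -
      have "i + r *\<^sub>R j \<in> J"
        using J(1) i(1) j by (intro subspace_add subspace_scale)
      then have "d \<le> norm (y - (i + r *\<^sub>R j))"
        unfolding d_def using infdist_le[of _ J y] by (simp add: dist_norm)
      also have "y - (i + r *\<^sub>R j) = r *\<^sub>R (z - j)"
        using r by (simp add: z_def algebra_simps)
      also have "norm \<dots> = r * norm (z - j)"
        using r by simp
      finally have "d \<le> r * norm (z - j)" .
      moreover have "r * norm (z - j) \<le> 2 * d * norm (z - j)"
        using i(2) by (intro mult_right_mono) (auto simp: r_def)
      ultimately have "d * 1 \<le> d * (2 * norm (z - j))" by simp
      then show ?thesis using d by (simp only: mult_le_cancel_left_pos)
    qed
  qed
qed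

section \<open>Approximation in a coset of an M-ideal\<close>

text \<open>This replaces the identity \<open>norm (t + (z - P* z)) = max (norm t) (norm (z - P* z))\<close> in the
  bidual. Minimising \<open>norm (t + w) + K * (\<Sum>u\<in>U. \<bar>u w\<bar>)\<close> over \<open>w \<in> z + J\<close> is a
  convex problem whose dual variables are a functional \<open>f\<close> of norm at most one and a functional
  \<open>g\<close> in the span of \<open>U\<close> such that \<open>f + g\<close> annihilates \<open>J\<close>; the dual value is
  \<open>f t + (f + g) z\<close>. Since \<open>P (f + g) = 0\<close>, \<open>g - P g\<close> kills \<open>z\<close> and \<open>f - P f\<close> kills \<open>t\<close>, this value is
  \<open>P f t + (f - P f) z\<close>, hence at most \<open>norm (P f) + norm (f - P f) = norm f\<close>. So the infimum is
  at most one, however large the penalty factor \<open>K\<close> is.\<close>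

lemma M_ideal_coset_approximation:
  fixes J :: "'a::real_normed_vector set" and P :: "('a \<Rightarrow>\<^sub>L real) \<Rightarrow> ('a \<Rightarrow>\<^sub>L real)"
  assumes J: "subspace J" and P: "linear P" "P \<circ> P = P" "{f. P f = 0} = annihilator J"
    and P_norm: "\<And>f. norm f = norm (P f) + norm (f - P f)"
    and t: "t \<in> J" "norm t \<le> 1" and z: "norm z \<le> 1"
    and U: "finite U" "\<And>u. u \<in> U \<Longrightarrow> blinfun_apply (u - P u) z = 0"
    and e: "0 < e"
  obtains j where "j \<in> J" "norm (t + (z - j)) \<le> 1 + e" "\<And>u. u \<in> U \<Longrightarrow> \<bar>blinfun_apply u (z - j)\<bar> \<le> e"
proof -
  \<comment> \<open>The penalty factor is such that a total cost of \<open>1 + e\<close> bounds the penalised sum by \<open>e\<close>.\<close>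
  define K where "K = (1 + e) / e"
  have K: "0 < K" using e by (simp add: K_def)
  define s where "s x = (\<Sum>u\<in>U. \<bar>blinfun_apply u x\<bar>)" for x
  define p where "p = (\<lambda>(a :: 'a, b). norm a + K * s b)"
  have "\<exists>j\<in>J. p (t + (z - j), z - j) < 1 + e"
  proof (rule ccontr)
    assume "\<not> ?thesis"
    then have far: "1 + e \<le> p (t + (z - j), z - j)" if "j \<in> J" for j
      using that by (auto simp: not_less)
    define C where "C = (\<lambda>j. (t + (z - j), z - j)) ` J"
    have "s (x + y) \<le> s x + s y" for x y
      by (simp add: s_def blinfun.add_right abs_triangle_ineq sum_mono flip: sum.distrib)
    moreover have s_scale: "s (r *\<^sub>R x) = \<bar>r\<bar> * s x" for r x
      by (simp add: s_def blinfun.scaleR_right abs_mult sum_distrib_left)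
    ultimately have "sublinear p"
    proof (intro sublinearI; clarsimp simp: p_def)
      fix a b c d :: 'a
      assume "\<And>x y. s (x + y) \<le> s x + s y"
      then have "K * s (b + d) \<le> K * (s b + s d)"
        using K by (intro mult_left_mono) auto
      then show "norm (a + c) + K * s (b + d) \<le> norm a + K * s b + (norm c + K * s d)"
        using norm_triangle_ineq[of a c] by (simp add: distrib_left)
    qed (simp add: algebra_simps)
    moreover have "C \<noteq> {}" using t(1) by (auto simp: C_def)
    moreover have "convex C"
    proof -
      have "C = (+) (t + z, z) ` (\<lambda>j. (- j, - j)) ` J"
        by (simp add: C_def image_image algebra_simps)
      moreover have "linear (\<lambda>j::'a. (- j, - j))"
        by (intro linearI) auto
      ultimately show ?thesis
        using subspace_imp_convex[OF J] by (simp add: convex_translation convex_linear_image)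
    qed
    moreover have "1 + e \<le> p c" if "c \<in> C" for c
      using far that by (auto simp: C_def)
    ultimately obtain F where F: "linear F" "\<And>x. F x \<le> p x" "\<And>c. c \<in> C \<Longrightarrow> 1 + e \<le> F c"
      using mazur_orlicz by blast

    have F_split: "F (a, b) = F (a, 0) + F (0, b)" for a b
      using linear_add[OF F(1), of "(a, 0)" "(0, b)"] by simp
    have s0: "s 0 = 0" by (simp add: s_def)
    have "linear (\<lambda>a. F (a, 0))"
      using linear_add[OF F(1)] linear_cmul[OF F(1)]
      by (intro linearI) (metis add_Pair add.right_neutral, metis scaleR_Pair scaleR_zero_right)
    moreover have "F (a, 0) \<le> norm a" for a
      using F(2)[of "(a, 0)"] s0 by (simp add: p_def)
    ultimately obtain f where f: "blinfun_apply f = (\<lambda>a. F (a, 0))" "norm f \<le> 1"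
      using blinfun_of_linear_le_norm[of "\<lambda>a. F (a, 0)"] by blast
    have g_lin: "linear (\<lambda>b. F (0, b))"
      using linear_add[OF F(1)] linear_cmul[OF F(1)]
      by (intro linearI) (metis add_Pair add.right_neutral, metis scaleR_Pair scaleR_zero_right)
    have g_le: "\<bar>F (0, b)\<bar> \<le> K * s b" for b
      using F(2)[of "(0, b)"] F(2)[of "(0, - b)"] linear_neg[OF g_lin, of b] s_scale[of "- 1" b]
      by (simp add: p_def abs_le_iff)
    have s_le: "s b \<le> (\<Sum>u\<in>U. norm u) * norm b" for b
      unfolding s_def sum_distrib_right by (intro sum_mono) (metis norm_blinfun real_norm_def)
    have "bounded_linear (\<lambda>b. F (0, b))"
    proof (rule bounded_linear_intro)
      show "norm (F (0, b)) \<le> norm b * (K * (\<Sum>u\<in>U. norm u))" for b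
        using order.trans[OF g_le mult_left_mono[OF s_le, of K b]] K by (simp add: mult_ac)
    qed (use linear_add[OF g_lin] linear_cmul[OF g_lin] in auto)
    then obtain g where g: "blinfun_apply g = (\<lambda>b. F (0, b))"
      using bounded_linear_Blinfun_apply by blast
    have "g \<in> span U"
    proof (rule blinfun_in_span_if_kernel[OF U(1)])
      fix x assume "\<forall>u\<in>U. blinfun_apply u x = 0"
      then have "s x = 0" by (simp add: s_def)
      then show "g x = 0" using g_le[of x] g by simp
    qed
    have lin: "linear (\<lambda>u. blinfun_apply (u - P u) z)"
      by (intro linearI)
        (simp_all add: linear_add[OF P(1)] linear_cmul[OF P(1)] blinfun.diff_left blinfun.add_left
          blinfun.scaleR_left algebra_simps)
    then have g_z: "blinfun_apply (g - P g) z = 0"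
      using linear_eq_0_on_span[OF lin _ \<open>g \<in> span U\<close>] U(2) by blast

    have below: "1 + e \<le> f t + (f + g) z - (f + g) j" if "j \<in> J" for j
    proof -
      have "1 + e \<le> F (t + (z - j), z - j)"
        using that by (intro F(3)) (auto simp: C_def)
      also have "\<dots> = f (t + (z - j)) + g (z - j)"
        using F_split[of "t + (z - j)" "z - j"] by (simp add: f(1) g)
      finally show ?thesis
        by (simp add: blinfun.add_left blinfun.add_right blinfun.diff_right)
    qed
    have "(f + g) j = 0" if "j \<in> J" for j
    proof (rule ccontr)
      assume nz: "(f + g) j \<noteq> 0"
      \<comment> \<open>This multiple of \<open>j\<close> makes the right-hand side of \<open>below\<close> vanish.\<close>
      define r where "r = (f t + (f + g) z) / (f + g) j"
      have "r *\<^sub>R j \<in> J" using J that by (rule subspace_scale)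
      from below[OF this] show False
        using nz e by (simp add: r_def blinfun.scaleR_right)
    qed
    then have "P (f + g) = 0"
      using P(3) by (auto simp: annihilator_def)
    then have "P f = - P g"
      using linear_add[OF P(1), of f g] by (simp add: eq_neg_iff_add_eq_0)
    then have fg: "(f + g) z = blinfun_apply (f - P f) z"
      using g_z by (simp add: blinfun.add_left blinfun.diff_left blinfun.minus_left)
    have "P (f - P f) = 0"
      using linear_diff[OF P(1)] fun_cong[OF P(2), of f] by simp
    then have "blinfun_apply (f - P f) t = 0"
      using P(3) t(1) by (auto simp: annihilator_def)
    then have "1 + e \<le> P f t + blinfun_apply (f - P f) z"
      using below[OF subspace_0[OF J]] by (simp add: fg blinfun.diff_left)
    also have "\<dots> \<le> norm (P f) * norm t + norm (f - P f) * norm z"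
      using norm_blinfun[of "P f" t] norm_blinfun[of "f - P f" z] by simp
    also have "\<dots> \<le> norm (P f) * 1 + norm (f - P f) * 1"
      using t(2) z by (intro add_mono mult_left_mono) auto
    also have "\<dots> \<le> 1"
      using P_norm[of f] f(2) by simp
    finally show False using e by simp
  qed
  then obtain j where j: "j \<in> J" "norm (t + (z - j)) + K * s (z - j) < 1 + e"
    by (auto simp: p_def)
  have s_nonneg: "0 \<le> s (z - j)" by (simp add: s_def sum_nonneg)
  have "K * s (z - j) \<le> 1 + e"
    using j(2) norm_ge_zero[of "t + (z - j)"] by linarith
  also have "\<dots> = K * e" using e by (simp add: K_def)
  finally have "s (z - j) \<le> e" using K by simp
  moreover have "\<bar>blinfun_apply u (z - j)\<bar> \<le> s (z - j)" if "u \<in> U" for u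
    unfolding s_def using U(1) that by (intro member_le_sum) auto
  ultimately have "\<bar>blinfun_apply u (z - j)\<bar> \<le> e" if "u \<in> U" for u
    using that by (meson order.trans)
  moreover have "0 \<le> K * s (z - j)" using K s_nonneg by simp
  ultimately show ?thesis using j by (intro that) auto
qed

text \<open>Weak neighbourhoods of \<open>t\<close> in the unit sphere contain points far from \<open>t\<close>. A functional
  norming \<open>t\<close> is added to the given ones: it keeps the norm of the perturbed vector from dropping,
  so that normalising moves that vector only a little.\<close>

lemma M_ideal_weak_neighbourhood_large:
  fixes J :: "'a::real_normed_vector set"
  assumes M: "M_ideal J" and inf: "infinite_codimension J"
    and t: "t \<in> J" "norm t = 1" and U: "finite (U :: ('a \<Rightarrow>\<^sub>L real) set)" and e: "0 < e"
  obtains y where "norm y = 1" "\<And>u. u \<in> U \<Longrightarrow> \<bar>blinfun_apply u y - blinfun_apply u t\<bar> < e"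
    "1 / 4 \<le> norm (y - t)"
proof -
  obtain P :: "('a \<Rightarrow>\<^sub>L real) \<Rightarrow> ('a \<Rightarrow>\<^sub>L real)" where J: "subspace J" "closed J"
    and P: "linear P" "P \<circ> P = P" "{f. P f = 0} = annihilator J"
      "\<And>f. norm f = norm (P f) + norm (f - P f)"
    using M by (auto simp: M_ideal_def)
  obtain k :: "'a \<Rightarrow>\<^sub>L real" where k: "norm k \<le> 1" "k t = 1"
    using exists_norming_functional[of t] t(2) by auto
  define U' where "U' = insert k U"
  \<comment> \<open>Approximation changes the value of \<open>u\<close> by at most \<open>d\<close>, normalising by at most
    \<open>norm u * d\<close>; together this is at most \<open>d * M\<close>.\<close>
  define M where "M = 1 + (\<Sum>u\<in>U. norm u)"
  define d where "d = min (1 / 4) (e / (2 * M))"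
  have M: "0 < M" by (simp add: M_def sum_nonneg add_pos_nonneg)
  have d: "0 < d" "d \<le> 1 / 4"
    using e M by (auto simp: d_def)
  have "d * M \<le> e / (2 * M) * M"
    using M by (intro mult_right_mono) (auto simp: d_def)
  also have "\<dots> < e" using e M by simp
  finally have d_e: "d * M < e" .

  have "P (u - P u) = 0" for u
    using linear_diff[OF P(1)] fun_cong[OF P(2), of u] by simp
  then have "(\<lambda>u. u - P u) ` U' \<subseteq> annihilator J"
    using P(3) by auto
  moreover have "finite ((\<lambda>u. u - P u) ` U')"
    using U by (simp add: U'_def)
  ultimately obtain z where z: "norm z = 1"
    "\<And>v. v \<in> (\<lambda>u. u - P u) ` U' \<Longrightarrow> blinfun_apply v z = 0"
    "\<And>j. j \<in> J \<Longrightarrow> 1 / 2 \<le> norm (z - j)"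
    using exists_unit_vector_far_from_subspace[OF J inf] by metis
  have U'_z: "blinfun_apply (u - P u) z = 0" if "u \<in> U'" for u
    using z(2) that by blast
  obtain j where j: "j \<in> J" "norm (t + (z - j)) \<le> 1 + d"
    "\<And>u. u \<in> U' \<Longrightarrow> \<bar>blinfun_apply u (z - j)\<bar> \<le> d"
    using M_ideal_coset_approximation[OF J(1) P t(1) _ _ _ U'_z d(1)] t(2) z(1) U
    by (metis U'_def finite_insert order.refl)
  define w where "w = z - j"
  define r where "r = norm (t + w)"
  have "1 - d \<le> k (t + w)"
    using j(3)[of k] k(2) by (simp add: U'_def w_def blinfun.add_right abs_le_iff)
  also have "\<dots> \<le> norm k * r"
    using norm_blinfun[of k "t + w"] by (simp add: r_def)
  also have "\<dots> \<le> 1 * r"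
    using k(1) by (intro mult_right_mono) (auto simp: r_def)
  finally have r: "1 - d \<le> r" "r \<le> 1 + d" "0 < r"
    using j(2) d(2) by (auto simp: r_def w_def)
  define y where "y = (1 / r) *\<^sub>R (t + w)"
  have "y - (t + w) = (1 / r - 1) *\<^sub>R (t + w)"
    by (simp add: y_def algebra_simps)
  then have "norm (y - (t + w)) = \<bar>1 / r - 1\<bar> * r"
    by (simp add: r_def)
  also have "\<dots> = \<bar>1 - r\<bar>"
    using r(3) by (simp add: abs_if field_simps)
  finally have near: "norm (y - (t + w)) \<le> d"
    using r by simp
  show ?thesis
  proof (rule that)
    show "norm y = 1" using r(3) by (simp add: y_def r_def)
    show "\<bar>blinfun_apply u y - blinfun_apply u t\<bar> < e" if u: "u \<in> U" for u
    proof -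
      have "norm u \<le> (\<Sum>u\<in>U. norm u)"
        using U u by (intro member_le_sum) auto
      then have "norm (u (y - (t + w))) \<le> (\<Sum>u\<in>U. norm u) * d"
        using near by (intro order.trans[OF norm_blinfun] mult_mono) (auto intro: sum_nonneg)
      moreover have "\<bar>u w\<bar> \<le> d" using j(3) u by (simp add: w_def U'_def)
      moreover have "u y - u t = u (y - (t + w)) + u w"
        by (simp add: blinfun.diff_right blinfun.add_right)
      ultimately show ?thesis using d_e by (simp add: M_def algebra_simps)
    qed
    have "1 / 2 \<le> norm w" using z(3) j(1) by (simp add: w_def)
    also have "w = (y - t) - (y - (t + w))" by simp
    also have "norm \<dots> \<le> norm (y - t) + norm (y - (t + w))" by (rule norm_triangle_ineq4)
    finally show "1 / 4 \<le> norm (y - t)" using near d(2) by simp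
  qed
qed

section \<open>Weak-star neighbourhoods of operators\<close>

text \<open>From some index \<open>N\<close> on, a Cauchy sequence of tensors stays within distance one of \<open>u N\<close>, so
  \<open>projective_norm (u N) + 1\<close> bounds the limit functional.\<close>

lemma bounded_linear_projective_pairing:
  fixes u :: "nat \<Rightarrow> ('a::real_normed_vector \<times> 'b::real_normed_vector) list"
  assumes u: "u \<in> projective_tensors"
  shows "bounded_linear (\<lambda>T. projective_pairing T u)"
proof -
  let ?a = "\<lambda>(T :: 'a \<Rightarrow>\<^sub>L ('b \<Rightarrow>\<^sub>L real)) us. tensor_apply (\<lambda>x y. T x y) us"
  note lim = projective_pairing_LIMSEQ[OF u]
  have add: "?a (S + T) us = ?a S us + ?a T us" for S T us
    by (induction us) (auto simp: tensor_apply_def blinfun.add_left)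
  have scale: "?a (r *\<^sub>R T) us = r * ?a T us" for r T us
    by (induction us) (auto simp: tensor_apply_def blinfun.scaleR_left distrib_left)
  obtain N where N: "\<And>m n. m \<ge> N \<Longrightarrow> n \<ge> N \<Longrightarrow> projective_norm (tensor_diff (u m) (u n)) < 1"
    using u zero_less_one unfolding projective_tensors_def by blast
  show ?thesis
  proof (rule bounded_linear_intro)
    fix S T :: "'a \<Rightarrow>\<^sub>L ('b \<Rightarrow>\<^sub>L real)" and r :: real
    show "projective_pairing (S + T) u = projective_pairing S u + projective_pairing T u"
      using LIMSEQ_unique[OF lim[of "S + T"]] tendsto_add[OF lim[of S] lim[of T]] by (simp add: add)
    show "projective_pairing (r *\<^sub>R T) u = r *\<^sub>R projective_pairing T u"
      using LIMSEQ_unique[OF lim[of "r *\<^sub>R T"]] tendsto_mult_left[OF lim[of T], of r]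
      by (simp add: scale)
    have "\<bar>?a T (u n)\<bar> \<le> norm T * (projective_norm (u N) + 1)" if n: "n \<ge> N" for n
    proof -
      have "\<bar>?a T (u n) - ?a T (u N)\<bar> \<le> norm T * projective_norm (tensor_diff (u n) (u N))"
        using abs_tensor_apply_le[of T "tensor_diff (u n) (u N)"]
        by (simp add: tensor_apply_diff[OF bilinear_blinfun2])
      also have "\<dots> \<le> norm T * 1"
        using N[OF n, of N] by (intro mult_left_mono) auto
      finally show ?thesis
        using abs_tensor_apply_le[of T "u N"] by (simp add: algebra_simps)
    qed
    then show "norm (projective_pairing T u) \<le> norm T * (projective_norm (u N) + 1)"
      using tendsto_rabs[OF lim[of T]] by (auto intro!: LIMSEQ_le_const2)
  qed
qed

lemma weak_star_open_contains_basic: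
  fixes T :: "'a::real_normed_vector \<Rightarrow>\<^sub>L ('b::real_normed_vector \<Rightarrow>\<^sub>L real)"
  assumes "openin weak_star W" "T \<in> W"
  shows "\<exists>(U :: (('a \<Rightarrow>\<^sub>L ('b \<Rightarrow>\<^sub>L real)) \<Rightarrow>\<^sub>L real) set) e. finite U \<and> 0 < e \<and>
    (\<forall>S. (\<forall>u\<in>U. \<bar>blinfun_apply u S - blinfun_apply u T\<bar> < e) \<longrightarrow> S \<in> W)"
proof -
  have "generate_topology_on
     {{T. projective_pairing T u \<in> U} | u U. u \<in> projective_tensors \<and> open U} W"
    using assms(1) unfolding weak_star_def openin_topology_generated_by_iff .
  then show ?thesis using assms(2)
  proof induction
    case Empty
    then show ?case by simp
  next
    case (Int V W)
    from Int.IH(1) Int.prems obtain U1 :: "(('a \<Rightarrow>\<^sub>L ('b \<Rightarrow>\<^sub>L real)) \<Rightarrow>\<^sub>L real) set" and e1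
      where 1: "finite U1" "0 < e1"
        "\<And>S. (\<forall>u\<in>U1. \<bar>blinfun_apply u S - blinfun_apply u T\<bar> < e1) \<Longrightarrow> S \<in> V"
      by blast
    from Int.IH(2) Int.prems obtain U2 :: "(('a \<Rightarrow>\<^sub>L ('b \<Rightarrow>\<^sub>L real)) \<Rightarrow>\<^sub>L real) set" and e2
      where 2: "finite U2" "0 < e2"
        "\<And>S. (\<forall>u\<in>U2. \<bar>blinfun_apply u S - blinfun_apply u T\<bar> < e2) \<Longrightarrow> S \<in> W"
      by blast
    from 1 2 show ?case
      by (intro exI[of _ "U1 \<union> U2"] exI[of _ "min e1 e2"]) auto
  next
    case (UN \<K>)
    then obtain V where V: "V \<in> \<K>" "T \<in> V" by blast
    with UN.IH[OF V] show ?case by blast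
  next
    case (Basis V)
    then obtain u A where u: "u \<in> projective_tensors" and A: "open A"
      and V: "V = {T. projective_pairing T u \<in> A}" by blast
    obtain e where e: "0 < e" "\<And>r. \<bar>r - projective_pairing T u\<bar> < e \<Longrightarrow> r \<in> A"
      using A Basis.prems unfolding V open_real by blast
    have "blinfun_apply (Blinfun (\<lambda>T. projective_pairing T u)) = (\<lambda>T. projective_pairing T u)"
      by (rule bounded_linear_Blinfun_apply[OF bounded_linear_projective_pairing[OF u]])
    then show ?case
      using e by (intro exI[of _ "{Blinfun (\<lambda>T. projective_pairing T u)}"] exI[of _ e]) (auto simp: V)
  qed
qed

theorem corollary4p4:
  assumes "M_ideal (compact_operators :: ('x::banach \<Rightarrow>\<^sub>L ('y::banach \<Rightarrow>\<^sub>L real)) set)"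
    and "infinite_codimension (compact_operators :: ('x \<Rightarrow>\<^sub>L ('y \<Rightarrow>\<^sub>L real)) set)"
  shows "\<forall>T \<in> (compact_operators :: ('x \<Rightarrow>\<^sub>L ('y \<Rightarrow>\<^sub>L real)) set). \<not> weak_star_norm_PC T"
proof (intro ballI notI)
  fix T :: "'x \<Rightarrow>\<^sub>L ('y \<Rightarrow>\<^sub>L real)"
  assume T: "T \<in> compact_operators" and PC: "weak_star_norm_PC T"
  have norm_T: "norm T = 1"
    using PC by (simp add: weak_star_norm_PC_def topcontinuous_at_def)
  let ?B = "sphere 0 1 \<inter> ball T (1 / 4)"
  have "openin (top_of_set (sphere 0 1)) ?B"
    by (simp add: openin_open_Int)
  moreover have "id T \<in> ?B" using norm_T by simp
  ultimately obtain V where V: "openin (subtopology weak_star (sphere 0 1)) V" "T \<in> V"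
    "\<forall>S\<in>V. id S \<in> ?B"
    using PC unfolding weak_star_norm_PC_def topcontinuous_at_def by blast
  obtain W where W: "openin weak_star W" "V = W \<inter> sphere 0 1"
    using V(1) by (auto simp: openin_subtopology)
  obtain U :: "(('x \<Rightarrow>\<^sub>L ('y \<Rightarrow>\<^sub>L real)) \<Rightarrow>\<^sub>L real) set" and e where U: "finite U" and e: "0 < e"
    and W_I: "\<And>S. (\<forall>u\<in>U. \<bar>blinfun_apply u S - blinfun_apply u T\<bar> < e) \<Longrightarrow> S \<in> W"
    using weak_star_open_contains_basic[OF W(1)] V(2) W(2) by blast
  obtain S where S: "norm S = 1" "\<And>u. u \<in> U \<Longrightarrow> \<bar>blinfun_apply u S - blinfun_apply u T\<bar> < e"
    "1 / 4 \<le> norm (S - T)"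
    using M_ideal_weak_neighbourhood_large[OF assms T norm_T U e] by blast
  have "S \<in> V" using W_I S(1,2) W(2) by simp
  then have "dist T S < 1 / 4" using V(3) by auto
  with S(3) show False by (simp add: dist_norm norm_minus_commute)
qed

end
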